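(* Let $\mathcal{B}\subseteq\mathbb{N}$ be a non-empty primitive set. Then $1_{\mathcal{E}}=\varphi_{W'}(\Delta(0))\in X_\varphi$.
   Context: $\mathbb{N}=\{1,2,\dots\}$. A set $\mathcal{B}\subseteq\mathbb{N}$ is primitive if there are no distinct $b,b'\in\mathcal{B}$ with $b\mid b'$. For $\mathcal{A}\subseteq\mathbb{N}$ let $\mathcal{M}_{\mathcal{A}}:=\bigcup_{a\in\mathcal{A}}a\mathbb{Z}$ and $\mathcal{F}_{\mathcal{A}}:=\mathbb{Z}\setminus\mathcal{M}_{\mathcal{A}}$. For finite $S\subseteq\mathcal{B}$ let $\mathcal{A}_S:=\{\gcd(b,\operatorname{lcm}(S)):b\in\mathcal{B}\}$ (with $\operatorname{lcm}(\emptyset)=1$), and let $\mathcal{E}:=\bigcup_{S\subseteq\mathcal{B},\,S\text{ finite}}\mathcal{F}_{\mathcal{A}_S}$; $1_{\mathcal{E}}\in\{0,1\}^{\mathbb{Z}}$ is its characteristic function. Let $\Delta:\mathbb{Z}\to\prod_{b\in\mathcal{B}}\mathbb{Z}/b\mathbb{Z}$, $\Delta(n)=(n,n,\dots)$, be the canonical diagonal embedding (the product carries the product topology of discrete finite groups), and let $H:=\overline{\Delta(\mathbb{Z})}$, a compact abelian group. The window is $W:=\{h\in H: h_b\neq 0\ \text{for all } b\in\mathcal{B}\}$, and $W':=\overline{\operatorname{int}(W)}$ (interior and closure in $H$). For $A\subseteq H$ the coding function $\varphi_A:H\to\{0,1\}^{\mathbb{Z}}$ is defined by $\varphi_A(h)(n)=1$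 if and only if $h+\Delta(n)\in A$; write $\varphi:=\varphi_W$. Let $X_\varphi:=\overline{\varphi(H)}$. *)

theory Defs
  imports "HOL-Analysis.Analysis" "HOL-Algebra.Product_Groups"
begin

definition primitive :: "nat set \<Rightarrow> bool" where
  "primitive B \<longleftrightarrow> (\<forall>b\<in>B. \<forall>b'\<in>B. b \<noteq> b' \<longrightarrow> \<not> b dvd b')"

definition multiples :: "nat set \<Rightarrow> int set" where
  "multiples A = (\<Union>a\<in>A. range (\<lambda>k. int a * k))"

definition free_numbers :: "nat set \<Rightarrow> int set" where
  "free_numbers A = UNIV - multiples A"

definition gcd_set :: "nat set \<Rightarrow> nat set \<Rightarrow> nat set" where
  "gcd_set B S = {gcd b (Lcm S) |b. b \<in> B}"

definition \<E> :: "nat set \<Rightarrow> int set" where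
  "\<E> B = (\<Union>S\<in>{S. S \<subseteq> B \<and> finite S}. free_numbers (gcd_set B S))"

text \<open>The product of the groups \<open>\<int>/b\<int>\<close>, \<open>b \<in> B\<close>: its elements are the extensional functions
  \<open>h\<close> on \<open>B\<close> whose value \<open>h b\<close> is the representative in \<open>{0..<b}\<close> of a residue class mod \<open>b\<close>.\<close>

definition residue_product :: "nat set \<Rightarrow> (nat \<Rightarrow> int) monoid" where
  "residue_product B = product_group B integer_mod_group"

definition residue_topology :: "nat set \<Rightarrow> (nat \<Rightarrow> int) topology" where
  "residue_topology B =
     product_topology (\<lambda>b. discrete_topology (carrier (integer_mod_group b))) B"

definition \<Delta> :: "nat set \<Rightarrow> int \<Rightarrow> (nat \<Rightarrow> int)" where
  "\<Delta> B n = (\<lambda>b\<in>B. n mod int b)"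

definition H :: "nat set \<Rightarrow> (nat \<Rightarrow> int) set" where
  "H B = residue_topology B closure_of range (\<Delta> B)"

definition H_topology :: "nat set \<Rightarrow> (nat \<Rightarrow> int) topology" where
  "H_topology B = subtopology (residue_topology B) (H B)"

definition window :: "nat set \<Rightarrow> (nat \<Rightarrow> int) set" where
  "window B = {h \<in> H B. \<forall>b\<in>B. h b \<noteq> 0}"

definition regular_window :: "nat set \<Rightarrow> (nat \<Rightarrow> int) set" where
  "regular_window B = H_topology B closure_of (H_topology B interior_of window B)"

definition coding :: "nat set \<Rightarrow> (nat \<Rightarrow> int) set \<Rightarrow> (nat \<Rightarrow> int) \<Rightarrow> (int \<Rightarrow> nat)" where
  "coding B A h = (\<lambda>n. indicator A (h \<otimes>\<^bsub>residue_product B\<^esub> \<Delta> B n))"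

definition shift_topology :: "(int \<Rightarrow> nat) topology" where
  "shift_topology = product_topology (\<lambda>_. discrete_topology {0, 1}) UNIV"

definition X\<^sub>\<phi> :: "nat set \<Rightarrow> (int \<Rightarrow> nat) set" where
  "X\<^sub>\<phi> B = shift_topology closure_of (coding B (window B) ` H B)"

end

theory Submission
  imports Defs
begin

text \<open>
  Give \<open>\<int>\<close> the topology whose neighbourhoods of \<open>n\<close> are the residue classes
  \<open>n + Lcm S \<cdot> \<int>\<close>, for finite \<open>S \<subseteq> B\<close>; this is the topology that \<open>\<Delta>\<close> pulls back from \<open>H\<close>.
  By Bezout, \<open>gcd b (Lcm S)\<close> divides \<open>n\<close> exactly when \<open>b\<close> divides a member of the class of \<open>n\<close>.
  So \<open>n \<in> \<E> B\<close> means that some class around \<open>n\<close> avoids all multiples of elements of \<open>B\<close>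
  (\<open>\<E>_iff\<close>), that is, \<open>\<Delta> B n\<close> is an interior point of the window (\<open>\<Delta>_in_interior_window_iff\<close>).

  The crucial point is that the complement of \<open>\<E> B\<close> is open as well (\<open>not_\<E>_shift\<close>):
  for \<open>n \<noteq> 0\<close> the number \<open>gcd n (Lcm S)\<close> is bounded, so it is eventually constant as \<open>S\<close> grows, and
  the divisors of \<open>n\<close> that witness \<open>n \<notin> \<E> B\<close> all divide this constant; they then
  divide every sufficiently close integer. Since \<open>\<Delta> B\<close> has dense range, passing to the
  closure of the interior therefore adds no point \<open>\<Delta> B n\<close>, which gives the first claim.

  For the second claim, a finite pattern of \<open>\<E> B\<close> has to be found in some \<open>\<phi>(\<Delta> k)\<close>. If \<open>k\<close> is close
  to \<open>0\<close>, the positions in \<open>\<E> B\<close> stay free of multiples. The positions outside \<open>\<E> B\<close> are turned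
  into multiples one after the other by ever smaller changes of \<open>k\<close>; openness of the complement
  guarantees that the remaining positions stay outside \<open>\<E> B\<close> meanwhile
  (\<open>finite_pattern_of_\<E>\<close>).
\<close>

section \<open>The set \<open>\<E>\<close> in terms of residue classes\<close>

lemma int_Lcm_dvd_iff: "int (Lcm S) dvd z \<longleftrightarrow> (\<forall>s\<in>S. int s dvd z)"
  by (simp flip: dvd_nat_abs_iff add: Lcm_dvd_iff)

lemma int_Lcm_dvd_mono: "S \<subseteq> T \<Longrightarrow> int (Lcm T) dvd z \<Longrightarrow> int (Lcm S) dvd z"
  by (auto simp: int_Lcm_dvd_iff)

text \<open>By Bezout \<open>gcd b l = u \<cdot> b + v \<cdot> l\<close>; if it divides \<open>n\<close> with quotient \<open>t\<close>, the shift
  \<open>k = - v \<cdot> l \<cdot> t\<close> turns \<open>n\<close> into the multiple \<open>u \<cdot> t \<cdot> b\<close> of \<open>b\<close>.\<close>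

lemma gcd_dvd_iff_dvd_shift:
  "int (gcd b l) dvd n \<longleftrightarrow> (\<exists>k. int l dvd k \<and> int b dvd n + k)"
proof
  assume "int (gcd b l) dvd n"
  then obtain t where t: "n = int (gcd b l) * t" by (elim dvdE)
  obtain u v where uv: "u * int b + v * int l = int (gcd b l)"
    using bezout_int[of "int b" "int l"] by (auto simp: gcd_int_int_eq)
  have "n + - (v * int l * t) = int b * (u * t)"
    unfolding t uv[symmetric] by (simp add: algebra_simps)
  then have "int b dvd n + - (v * int l * t)" by simp
  moreover have "int l dvd - (v * int l * t)" by simp
  ultimately show "\<exists>k. int l dvd k \<and> int b dvd n + k" by blast
next
  assume "\<exists>k. int l dvd k \<and> int b dvd n + k"
  then obtain k where k: "int l dvd k" "int b dvd n + k" by blast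
  have "int (gcd b l) dvd int l" "int (gcd b l) dvd int b"
    by (simp_all only: int_dvd_int_iff gcd_dvd1 gcd_dvd2)
  then have "int (gcd b l) dvd k" "int (gcd b l) dvd n + k"
    using k dvd_trans by blast+
  then show "int (gcd b l) dvd n" by (simp add: dvd_add_left_iff)
qed

lemma \<E>_iff_gcd:
  "n \<in> \<E> B \<longleftrightarrow> (\<exists>S. S \<subseteq> B \<and> finite S \<and> (\<forall>b\<in>B. \<not> int (gcd b (Lcm S)) dvd n))"
proof -
  have "n \<in> free_numbers (gcd_set B S) \<longleftrightarrow> (\<forall>b\<in>B. \<not> int (gcd b (Lcm S)) dvd n)" for S
    by (auto simp: free_numbers_def multiples_def gcd_set_def dvd_def)
  then show ?thesis
    by (simp add: \<E>_def)
qed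

text \<open>This replaces the sets \<open>gcd_set B S\<close> by residue classes, which are what cylinder sets of \<open>H\<close>
  cut out of the diagonal.\<close>

lemma \<E>_iff:
  "n \<in> \<E> B \<longleftrightarrow> (\<exists>S. S \<subseteq> B \<and> finite S \<and>
     (\<forall>k. int (Lcm S) dvd k \<longrightarrow> (\<forall>b\<in>B. \<not> int b dvd n + k)))"
proof -
  have "(\<forall>b\<in>B. \<not> int (gcd b (Lcm S)) dvd n) \<longleftrightarrow>
      (\<forall>k. int (Lcm S) dvd k \<longrightarrow> (\<forall>b\<in>B. \<not> int b dvd n + k))" for S
    unfolding gcd_dvd_iff_dvd_shift by blast
  then show ?thesis
    by (simp add: \<E>_iff_gcd)
qed

lemma not_\<E>_gcd_dvd:
  assumes "n \<notin> \<E> B" "S \<subseteq> B" "finite S"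
  obtains b where "b \<in> B" "int (gcd b (Lcm S)) dvd n"
  using assms by (auto simp: \<E>_iff_gcd)

lemma \<E>_not_dvd: "n \<in> \<E> B \<Longrightarrow> b \<in> B \<Longrightarrow> \<not> int b dvd n"
  by (auto simp: \<E>_iff dest: spec[of _ 0])

text \<open>\<open>\<E> B\<close> is open: every point of a class that avoids all multiples has the same class as
  witness.\<close>

lemma \<E>_shift:
  assumes "n \<in> \<E> B"
  obtains S where "S \<subseteq> B" "finite S" "\<And>k. int (Lcm S) dvd k \<Longrightarrow> n + k \<in> \<E> B"
proof -
  obtain S where S: "S \<subseteq> B" "finite S"
      and free: "\<And>k b. int (Lcm S) dvd k \<Longrightarrow> b \<in> B \<Longrightarrow> \<not> int b dvd n + k"
    using assms unfolding \<E>_iff by (elim exE conjE) simp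
  have "n + k \<in> \<E> B" if "int (Lcm S) dvd k" for k
    unfolding \<E>_iff
  proof (intro exI[of _ S] conjI allI impI ballI)
    fix j b assume "int (Lcm S) dvd j" "b \<in> B"
    then show "\<not> int b dvd n + k + j"
      using free[of "k + j" b] that by (simp add: add.assoc)
  qed (use S in auto)
  with S show thesis using that by blast
qed

text \<open>The complement of \<open>\<E> B\<close> is open.
  For \<open>n \<noteq> 0\<close> choose \<open>S\<close> with \<open>g = gcd n (Lcm S)\<close> maximal. For \<open>T \<supseteq> S\<close> a divisor
  \<open>gcd b (Lcm T)\<close> of \<open>n\<close> still divides \<open>g\<close>, and \<open>g\<close> divides all of \<open>n + Lcm S \<cdot> \<int>\<close>. For \<open>n = 0\<close> there
  is no maximum, but there any single \<open>b \<in> B\<close> gives the neighbourhood \<open>b \<int>\<close>.\<close>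

lemma not_\<E>_shift:
  assumes "B \<noteq> {}" and "n \<notin> \<E> B"
  obtains S where "S \<subseteq> B" "finite S" "\<And>k. int (Lcm S) dvd k \<Longrightarrow> n + k \<notin> \<E> B"
proof (cases "n = 0")
  case True
  from assms(1) obtain b where b: "b \<in> B" by blast
  have "n + k \<notin> \<E> B" if "int (Lcm {b}) dvd k" for k
    using \<E>_not_dvd[of k B b] b that True by auto
  with b show thesis using that[of "{b}"] by simp
next
  case False
  define f where "f S = gcd (nat \<bar>n\<bar>) (Lcm S)" for S :: "nat set"
  have f_le: "f S \<le> nat \<bar>n\<bar>" for S
    unfolding f_def using False by (intro gcd_le1_nat) auto
  have f_pos: "f S > 0" for S
    unfolding f_def using False by simp
  have "\<exists>S. (S \<subseteq> B \<and> finite S) \<and> (\<forall>T. T \<subseteq> B \<and> finite T \<longrightarrow> f T \<le> f S)"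
    by (rule ex_has_greatest_nat[where k = "{}" and b = "Suc (nat \<bar>n\<bar>)"])
      (use f_le in \<open>auto simp: less_Suc_eq_le\<close>)
  then obtain S where S: "S \<subseteq> B" "finite S"
      and maximal: "\<And>T. T \<subseteq> B \<Longrightarrow> finite T \<Longrightarrow> f T \<le> f S"
    by blast
  have "n + k \<notin> \<E> B" if k: "int (Lcm S) dvd k" for k
    unfolding \<E>_iff_gcd
  proof clarify
    fix T assume T: "T \<subseteq> B" "finite T" and free: "\<forall>b\<in>B. \<not> int (gcd b (Lcm T)) dvd n + k"
    \<comment> \<open>Enlarging \<open>T\<close> only enlarges \<open>gcd b (Lcm T)\<close>, so a witness for \<open>S \<union> T\<close> suffices.\<close>
    have "f S dvd f (S \<union> T)"
      unfolding f_def by (intro gcd_mono dvd_refl Lcm_subset) auto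
    moreover have "f (S \<union> T) \<le> f S"
      using S T by (intro maximal) auto
    ultimately have eq: "f (S \<union> T) = f S"
      using f_pos dvd_imp_le le_antisym by blast
    obtain b where b: "b \<in> B" and "int (gcd b (Lcm (S \<union> T))) dvd n"
      using not_\<E>_gcd_dvd[OF assms(2), of "S \<union> T"] S T by auto
    then have "gcd b (Lcm (S \<union> T)) dvd f (S \<union> T)"
      unfolding f_def by (intro gcd_greatest gcd_dvd2) (simp only: dvd_nat_abs_iff)
    then have "gcd b (Lcm (S \<union> T)) dvd f S"
      unfolding eq .
    moreover have "gcd b (Lcm T) dvd gcd b (Lcm (S \<union> T))"
      by (intro gcd_mono dvd_refl Lcm_subset) auto
    ultimately have "int (gcd b (Lcm T)) dvd int (f S)"
      unfolding int_dvd_int_iff using dvd_trans by blast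
    moreover have "int (f S) dvd n" "int (f S) dvd int (Lcm S)"
      by (simp_all add: f_def flip: dvd_nat_abs_iff)
    ultimately have "int (gcd b (Lcm T)) dvd n + k"
      using k by (meson dvd_add dvd_trans)
    with free b show False by blast
  qed
  with S show thesis using that by blast
qed

section \<open>Finite patterns\<close>

text \<open>All changes of \<open>k\<close> are multiples of \<open>Lcm T\<close>, so positions not yet treated stay outside \<open>\<E> B\<close>;
  keeping the divisors found so far in \<open>S\<close> protects the positions already treated.\<close>

lemma shift_to_multiples:
  assumes "finite N" "finite T" "T \<subseteq> B"
    and "\<And>n k. n \<in> N \<Longrightarrow> int (Lcm T) dvd k \<Longrightarrow> n + k \<notin> \<E> B"
  shows "\<exists>k S. finite S \<and> T \<subseteq> S \<and> S \<subseteq> B \<and> int (Lcm T) dvd k \<and> (\<forall>n\<in>N. \<exists>b\<in>S. int b dvd n + k)"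
  using assms(1,4)
proof (induction N rule: finite_induct)
  case empty
  show ?case using assms(2,3) by (intro exI[of _ 0] exI[of _ T]) auto
next
  case (insert n N)
  then obtain k S where S: "finite S" "T \<subseteq> S" "S \<subseteq> B" and k: "int (Lcm T) dvd k"
      and mult: "\<forall>n\<in>N. \<exists>b\<in>S. int b dvd n + k"
    by (metis insert_iff)
  have "n + k \<notin> \<E> B" using insert.prems k by blast
  then obtain j b where j: "int (Lcm S) dvd j" and b: "b \<in> B" "int b dvd n + k + j"
    using not_\<E>_gcd_dvd[of "n + k" B S] S unfolding gcd_dvd_iff_dvd_shift by metis
  have "\<exists>c\<in>insert b S. int c dvd m + (k + j)" if "m \<in> insert n N" for m
  proof (cases "m = n")
    case True
    with b show ?thesis by (auto simp: add.assoc)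
  next
    case False
    with that mult obtain c where c: "c \<in> S" "int c dvd m + k" by blast
    moreover have "int c dvd j" using j c(1) by (simp add: int_Lcm_dvd_iff)
    ultimately have "int c dvd m + k + j" by simp
    with c(1) show ?thesis by (auto simp: add.assoc)
  qed
  moreover have "int (Lcm T) dvd k + j"
    using k int_Lcm_dvd_mono[OF S(2) j] by simp
  ultimately show ?case
    using S b(1) by (intro exI[of _ "k + j"] exI[of _ "insert b S"]) auto
qed

text \<open>Choose \<open>T\<close> so large that membership of every \<open>n \<in> N\<close> in \<open>\<E> B\<close> is unaffected by multiples of
  \<open>Lcm T\<close>; among these shifts the previous lemma finds one that makes the positions outside \<open>\<E> B\<close>
  multiples, and members of \<open>\<E> B\<close> are never multiples.\<close>

lemma finite_pattern_of_\<E>: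
  assumes "B \<noteq> {}" "finite N"
  shows "\<exists>k. \<forall>n\<in>N. n \<in> \<E> B \<longleftrightarrow> (\<forall>b\<in>B. \<not> int b dvd n + k)"
proof -
  have "\<exists>S. S \<subseteq> B \<and> finite S \<and> (\<forall>k. int (Lcm S) dvd k \<longrightarrow> (n + k \<in> \<E> B \<longleftrightarrow> n \<in> \<E> B))" for n
    by (cases "n \<in> \<E> B") (meson \<E>_shift, meson not_\<E>_shift assms(1))
  then obtain S where S: "\<And>n. S n \<subseteq> B" "\<And>n. finite (S n)"
      and stable: "\<And>n k. int (Lcm (S n)) dvd k \<Longrightarrow> n + k \<in> \<E> B \<longleftrightarrow> n \<in> \<E> B"
    by metis
  define T where "T = (\<Union>n\<in>N. S n)"
  have T: "T \<subseteq> B" "finite T"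
    using S assms(2) by (auto simp: T_def)
  have stable': "n + k \<in> \<E> B \<longleftrightarrow> n \<in> \<E> B" if "n \<in> N" "int (Lcm T) dvd k" for n k
    using that by (intro stable int_Lcm_dvd_mono[of "S n" T k]) (auto simp: T_def)
  obtain k S' where k: "int (Lcm T) dvd k" and "S' \<subseteq> B"
      "\<forall>n\<in>N - \<E> B. \<exists>b\<in>S'. int b dvd n + k"
    using shift_to_multiples[of "N - \<E> B" T B] assms(2) T stable' by auto
  then have "n \<in> \<E> B \<longleftrightarrow> (\<forall>b\<in>B. \<not> int b dvd n + k)" if "n \<in> N" for n
    using \<E>_not_dvd[of "n + k" B] stable'[OF that k] that by blast
  then show ?thesis by blast
qed

section \<open>Cylinder sets in products of discrete spaces\<close>

lemma cylinder_in_open: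
  assumes "openin (product_topology (\<lambda>i. discrete_topology (A i)) I) U" "x \<in> U"
  obtains S where "finite S" "S \<subseteq> I" "\<And>y. y \<in> Pi\<^sub>E I A \<Longrightarrow> (\<And>i. i \<in> S \<Longrightarrow> y i = x i) \<Longrightarrow> y \<in> U"
proof -
  obtain V where V: "finite {i \<in> I. V i \<noteq> A i}" "x \<in> Pi\<^sub>E I V" "Pi\<^sub>E I V \<subseteq> U"
    using assms unfolding openin_product_topology_alt by auto
  show thesis
  proof (rule that[of "{i \<in> I. V i \<noteq> A i}"])
    fix y assume y: "y \<in> Pi\<^sub>E I A" "\<And>i. i \<in> {i \<in> I. V i \<noteq> A i} \<Longrightarrow> y i = x i"
    have "y i \<in> V i" if "i \<in> I" for i
      using y(1) y(2)[of i] V(2) that by (cases "V i = A i") (auto simp: PiE_iff)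
    with y(1) have "y \<in> Pi\<^sub>E I V" by (auto simp: PiE_iff)
    with V(3) show "y \<in> U" by blast
  qed (use V in auto)
qed

lemma openin_cylinder:
  assumes "finite S" "S \<subseteq> I"
  shows "openin (product_topology (\<lambda>i. discrete_topology (A i)) I)
           {y \<in> Pi\<^sub>E I A. \<forall>i\<in>S. y i = x i}"
proof -
  have "{y \<in> Pi\<^sub>E I A. \<forall>i\<in>S. y i = x i} = Pi\<^sub>E I (\<lambda>i. if i \<in> S then A i \<inter> {x i} else A i)"
    using assms(2) by (auto simp: PiE_iff extensional_def split: if_splits)
  moreover have "finite {i \<in> I. (if i \<in> S then A i \<inter> {x i} else A i) \<noteq> A i}"
    by (rule finite_subset[OF _ assms(1)]) auto
  ultimately show ?thesis
    by (simp add: openin_PiE_gen)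
qed

lemma closure_of_discrete_product_iff:
  "x \<in> product_topology (\<lambda>i. discrete_topology (A i)) I closure_of Y \<longleftrightarrow>
     x \<in> Pi\<^sub>E I A \<and>
     (\<forall>S. finite S \<longrightarrow> S \<subseteq> I \<longrightarrow> (\<exists>y\<in>Y. y \<in> Pi\<^sub>E I A \<and> (\<forall>i\<in>S. y i = x i)))"
  (is "?L \<longleftrightarrow> ?R")
proof
  assume L: ?L
  then have x: "x \<in> Pi\<^sub>E I A" by (simp add: in_closure_of)
  show ?R
  proof (intro conjI allI impI x)
    fix S assume "finite S" "S \<subseteq> I"
    define C where "C = {y \<in> Pi\<^sub>E I A. \<forall>i\<in>S. y i = x i}"
    have "openin (product_topology (\<lambda>i. discrete_topology (A i)) I) C"
      unfolding C_def by (rule openin_cylinder) fact+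
    moreover have "x \<in> C" using x by (simp add: C_def)
    ultimately obtain y where "y \<in> Y" "y \<in> C"
      using L unfolding in_closure_of by meson
    then show "\<exists>y\<in>Y. y \<in> Pi\<^sub>E I A \<and> (\<forall>i\<in>S. y i = x i)"
      by (auto simp: C_def)
  qed
next
  assume R: ?R
  show ?L
    unfolding in_closure_of
  proof (intro conjI allI impI)
    fix U assume U: "x \<in> U \<and> openin (product_topology (\<lambda>i. discrete_topology (A i)) I) U"
    obtain S where S: "finite S" "S \<subseteq> I"
        and cyl: "\<And>y. y \<in> Pi\<^sub>E I A \<Longrightarrow> (\<And>i. i \<in> S \<Longrightarrow> y i = x i) \<Longrightarrow> y \<in> U"
      using cylinder_in_open[OF conjunct2[OF U] conjunct1[OF U]] by metis
    obtain y where "y \<in> Y" "y \<in> Pi\<^sub>E I A" "\<forall>i\<in>S. y i = x i"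
      using R S by meson
    with cyl show "\<exists>y. y \<in> Y \<and> y \<in> U" by metis
  qed (use R in simp)
qed

section \<open>The diagonal embedding and the window\<close>

lemma \<Delta>_in_PiE:
  assumes "B \<subseteq> {1..}"
  shows "\<Delta> B n \<in> (\<Pi>\<^sub>E b\<in>B. carrier (integer_mod_group b))"
  using assms by (auto simp: \<Delta>_def carrier_integer_mod_group subset_iff)

lemma \<Delta>_mult:
  assumes "B \<subseteq> {1..}"
  shows "\<Delta> B m \<otimes>\<^bsub>residue_product B\<^esub> \<Delta> B n = \<Delta> B (m + n)"
  using assms
  by (auto simp: \<Delta>_def residue_product_def mult_integer_mod_group fun_eq_iff mod_simps)

lemma \<Delta>_agree_iff:
  assumes "S \<subseteq> B"
  shows "(\<forall>b\<in>S. \<Delta> B m b = \<Delta> B n b) \<longleftrightarrow> int (Lcm S) dvd m - n"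
  using assms by (auto simp: int_Lcm_dvd_iff \<Delta>_def mod_eq_dvd_iff subset_iff)

lemma in_H_iff:
  assumes "B \<subseteq> {1..}"
  shows "h \<in> H B \<longleftrightarrow> h \<in> (\<Pi>\<^sub>E b\<in>B. carrier (integer_mod_group b)) \<and>
           (\<forall>S. finite S \<longrightarrow> S \<subseteq> B \<longrightarrow> (\<exists>n. \<forall>b\<in>S. \<Delta> B n b = h b))"
  using \<Delta>_in_PiE[OF assms]
  by (simp add: H_def residue_topology_def closure_of_discrete_product_iff)

lemma \<Delta>_approximates:
  assumes "B \<subseteq> {1..}" "h \<in> H B" "finite S" "S \<subseteq> B"
  obtains n where "\<forall>b\<in>S. \<Delta> B n b = h b"
  using assms(2-4) in_H_iff[OF assms(1)] by auto

lemma \<Delta>_in_H: "B \<subseteq> {1..} \<Longrightarrow> \<Delta> B n \<in> H B"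
  by (auto simp: in_H_iff \<Delta>_in_PiE)

lemma \<Delta>_in_window_iff:
  assumes "B \<subseteq> {1..}"
  shows "\<Delta> B n \<in> window B \<longleftrightarrow> (\<forall>b\<in>B. \<not> int b dvd n)"
  unfolding window_def using \<Delta>_in_H[OF assms]
  by (simp add: \<Delta>_def dvd_eq_mod_eq_0)

lemma openin_H_cylinder:
  assumes "B \<subseteq> {1..}" "finite S" "S \<subseteq> B"
  shows "openin (H_topology B) {g \<in> H B. \<forall>b\<in>S. g b = h b}"
proof -
  have "{g \<in> H B. \<forall>b\<in>S. g b = h b} =
      H B \<inter> {g \<in> (\<Pi>\<^sub>E b\<in>B. carrier (integer_mod_group b)). \<forall>b\<in>S. g b = h b}"
    using in_H_iff[OF assms(1)] by blast
  then show ?thesis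
    unfolding H_topology_def residue_topology_def
    by (simp only: openin_subtopology_Int2 openin_cylinder[OF assms(2,3)])
qed

lemma H_cylinder_in_open:
  assumes "B \<subseteq> {1..}" "openin (H_topology B) U" "h \<in> U"
  obtains S where "finite S" "S \<subseteq> B" "\<And>g. g \<in> H B \<Longrightarrow> (\<And>b. b \<in> S \<Longrightarrow> g b = h b) \<Longrightarrow> g \<in> U"
proof -
  obtain V where V: "openin (residue_topology B) V" "U = V \<inter> H B"
    using assms(2) unfolding H_topology_def openin_subtopology by blast
  have "h \<in> V" using V(2) assms(3) by simp
  obtain S where S: "finite S" "S \<subseteq> B"
      and cyl: "\<And>g. g \<in> (\<Pi>\<^sub>E b\<in>B. carrier (integer_mod_group b)) \<Longrightarrow>
        (\<And>b. b \<in> S \<Longrightarrow> g b = h b) \<Longrightarrow> g \<in> V"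
    using cylinder_in_open[OF V(1)[unfolded residue_topology_def] \<open>h \<in> V\<close>] by metis
  show thesis
  proof (rule that[OF S])
    fix g assume "g \<in> H B" "\<And>b. b \<in> S \<Longrightarrow> g b = h b"
    with cyl show "g \<in> U" by (simp add: V(2) in_H_iff[OF assms(1)])
  qed
qed

text \<open>The points \<open>\<Delta> B m\<close> in the cylinder around \<open>\<Delta> B n\<close> over \<open>S\<close> are those with
  \<open>m \<in> n + Lcm S \<cdot> \<int>\<close>. A point \<open>g\<close> of the cylinder with \<open>g b = 0\<close> can be approximated on
  \<open>S \<union> {b}\<close> by such a \<open>\<Delta> B m\<close>, so it is enough to exclude zero coordinates on the diagonal.\<close>

lemma \<Delta>_in_interior_window_iff:
  assumes "B \<subseteq> {1..}"
  shows "\<Delta> B n \<in> H_topology B interior_of window B \<longleftrightarrow> n \<in> \<E> B"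
proof
  assume "\<Delta> B n \<in> H_topology B interior_of window B"
  then obtain S where S: "finite S" "S \<subseteq> B" and interior:
      "\<And>g. g \<in> H B \<Longrightarrow> (\<And>b. b \<in> S \<Longrightarrow> g b = \<Delta> B n b) \<Longrightarrow> g \<in> H_topology B interior_of window B"
    using H_cylinder_in_open[OF assms openin_interior_of] by metis
  have cyl: "g \<in> window B" if "g \<in> H B" "\<forall>b\<in>S. g b = \<Delta> B n b" for g
    using interior[of g] that interior_of_subset by fast
  have "\<Delta> B (n + k) \<in> window B" if "int (Lcm S) dvd k" for k
    by (rule cyl) (use assms that S(2) in \<open>simp_all add: \<Delta>_in_H \<Delta>_agree_iff\<close>)
  then show "n \<in> \<E> B"
    unfolding \<E>_iff \<Delta>_in_window_iff[OF assms] using S by (intro exI[of _ S]) simp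
next
  assume "n \<in> \<E> B"
  then obtain S where S: "S \<subseteq> B" "finite S" and shift: "\<And>k. int (Lcm S) dvd k \<Longrightarrow> n + k \<in> \<E> B"
    using \<E>_shift by metis
  let ?C = "{g \<in> H B. \<forall>b\<in>S. g b = \<Delta> B n b}"
  have "?C \<subseteq> window B"
    unfolding window_def
  proof clarify
    fix g b assume g: "g \<in> H B" "\<forall>b\<in>S. g b = \<Delta> B n b" and b: "b \<in> B" "g b = 0"
    obtain m where "\<forall>c\<in>insert b S. \<Delta> B m c = g c"
      using \<Delta>_approximates[OF assms g(1), of "insert b S"] S b(1) by auto
    then have m: "\<forall>c\<in>S. \<Delta> B m c = \<Delta> B n c" "\<Delta> B m b = 0"
      using g(2) b(2) by simp_all
    then have "m \<in> \<E> B"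
      using shift[of "m - n"] \<Delta>_agree_iff[OF S(1)] by simp
    moreover have "int b dvd m"
      using m(2) b(1) by (simp add: \<Delta>_def dvd_eq_mod_eq_0)
    ultimately show False using \<E>_not_dvd b(1) by blast
  qed
  moreover have "openin (H_topology B) ?C"
    using openin_H_cylinder assms S by blast
  moreover have "\<Delta> B n \<in> ?C"
    using \<Delta>_in_H[OF assms] by simp
  ultimately show "\<Delta> B n \<in> H_topology B interior_of window B"
    unfolding interior_of_def by (auto intro!: exI[of _ ?C])
qed

text \<open>If \<open>n \<notin> \<E> B\<close>, a whole cylinder around \<open>\<Delta> B n\<close> meets the diagonal only in points outside
  the interior of the window. The interior is open and the diagonal dense, so the cylinder misses
  the interior altogether.\<close>

lemma \<Delta>_in_regular_window_iff:
  assumes "B \<subseteq> {1..}" "B \<noteq> {}"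
  shows "\<Delta> B n \<in> regular_window B \<longleftrightarrow> n \<in> \<E> B"
proof
  assume "n \<in> \<E> B"
  then have "\<Delta> B n \<in> H_topology B interior_of window B"
    using \<Delta>_in_interior_window_iff assms(1) by blast
  then show "\<Delta> B n \<in> regular_window B"
    unfolding regular_window_def
    by (meson closure_of_subset interior_of_subset_topspace subsetD)
next
  assume closure: "\<Delta> B n \<in> regular_window B"
  show "n \<in> \<E> B"
  proof (rule ccontr)
    assume "n \<notin> \<E> B"
    then obtain S where S: "S \<subseteq> B" "finite S" and shift: "\<And>k. int (Lcm S) dvd k \<Longrightarrow> n + k \<notin> \<E> B"
      using not_\<E>_shift[OF assms(2)] by metis
    define C where "C = {g \<in> H B. \<forall>b\<in>S. g b = \<Delta> B n b}"
    have "openin (H_topology B) C"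
      unfolding C_def by (rule openin_H_cylinder[OF assms(1) S(2,1)])
    moreover have "\<Delta> B n \<in> C"
      using \<Delta>_in_H[OF assms(1)] by (simp add: C_def)
    ultimately obtain h where h: "h \<in> H_topology B interior_of window B" "h \<in> C"
      using closure unfolding regular_window_def in_closure_of by meson
    then have h_H: "h \<in> H B" and h_S: "\<forall>b\<in>S. h b = \<Delta> B n b"
      by (simp_all add: C_def)
    obtain T where T: "finite T" "T \<subseteq> B"
      and cyl: "\<And>g. g \<in> H B \<Longrightarrow> (\<And>b. b \<in> T \<Longrightarrow> g b = h b) \<Longrightarrow> g \<in> H_topology B interior_of window B"
      using H_cylinder_in_open[OF assms(1) openin_interior_of h(1)] by metis
    \<comment> \<open>By density, \<open>h\<close> may be replaced by a point of the diagonal that is interior as well.\<close>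
    obtain m where m: "\<forall>b\<in>S \<union> T. \<Delta> B m b = h b"
      using \<Delta>_approximates[OF assms(1) h_H, of "S \<union> T"] S T by auto
    then have "\<Delta> B m \<in> H_topology B interior_of window B"
      by (intro cyl \<Delta>_in_H assms(1)) auto
    then have "m \<in> \<E> B"
      using \<Delta>_in_interior_window_iff assms(1) by blast
    moreover have "int (Lcm S) dvd m - n"
      using m h_S by (simp flip: \<Delta>_agree_iff[OF S(1)])
    ultimately show False using shift[of "m - n"] by simp
  qed
qed

lemma coding_\<Delta>:
  assumes "B \<subseteq> {1..}"
  shows "coding B A (\<Delta> B k) n = indicator A (\<Delta> B (k + n))"
  using assms by (simp add: coding_def \<Delta>_mult)

lemma indicator_\<E>_in_X\<^sub>\<phi>:
  assumes "B \<subseteq> {1..}" "B \<noteq> {}"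
  shows "indicator (\<E> B) \<in> X\<^sub>\<phi> B"
  unfolding X\<^sub>\<phi>_def shift_topology_def closure_of_discrete_product_iff
proof (intro conjI allI impI)
  show "indicator (\<E> B) \<in> (\<Pi>\<^sub>E i\<in>UNIV. {0, 1 :: nat})"
    by (auto simp: indicator_def)
  fix N :: "int set" assume "finite N"
  then obtain k where k: "\<forall>n\<in>N. n \<in> \<E> B \<longleftrightarrow> (\<forall>b\<in>B. \<not> int b dvd n + k)"
    using finite_pattern_of_\<E> assms(2) by blast
  have "coding B (window B) (\<Delta> B k) n = indicator (\<E> B) n" if "n \<in> N" for n
    using k that assms(1)
    by (simp add: coding_\<Delta> \<Delta>_in_window_iff indicator_def add.commute)
  moreover have "coding B (window B) (\<Delta> B k) \<in> (\<Pi>\<^sub>E i\<in>UNIV. {0, 1 :: nat})"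
    by (auto simp: coding_def indicator_def)
  ultimately show "\<exists>y\<in>coding B (window B) ` H B.
      y \<in> (\<Pi>\<^sub>E i\<in>UNIV. {0, 1}) \<and> (\<forall>n\<in>N. y n = indicator (\<E> B) n)"
    using \<Delta>_in_H[OF assms(1)] by blast
qed

theorem corollary4:
  fixes B :: "nat set"
  assumes "B \<subseteq> {1..}" and "B \<noteq> {}" and "primitive B"
  shows "indicator (\<E> B) = coding B (regular_window B) (\<Delta> B 0)
    \<and> coding B (regular_window B) (\<Delta> B 0) \<in> X\<^sub>\<phi> B"
proof -
  have "indicator (\<E> B) = coding B (regular_window B) (\<Delta> B 0)"
    using assms(1,2)
    by (simp add: fun_eq_iff coding_\<Delta> \<Delta>_in_regular_window_iff indicator_def)
  with indicator_\<E>_in_X\<^sub>\<phi>[OF assms(1,2)] show ?thesis by simp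
qed

end
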